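(* Let $(X,d)$ be a locally compact metric space. The action $(Iso(X),X)$ is proper if and only if it is Cauchy-indivisible.
   Context: $Iso(X)$ is the group of surjective isometries of $(X,d)$ with the topology of pointwise convergence; it acts on $X$ by evaluation. For a net $\{z_i\}$ in a space $Z$, "$z_i\to\infty$ in $Z$" means that $\{z_i\}$ has no convergent subnet in $Z$. The action $(Iso(X),X)$ is proper if for every $x\in X$ there are no $y\in X$ and nets $\{x_i\}$ in $X$, $\{g_i\}$ in $Iso(X)$ with $g_i\to\infty$ in $Iso(X)$, $x_i\to x$ and $g_ix_i\to y$. The action is Cauchy-indivisible if: whenever $\{g_i\}$ is a net in $Iso(X)$ with $g_i\to\infty$ in $Iso(X)$ and $\{g_ix\}$ is a Cauchy net for some $x\in X$, then $\{g_ix\}$ is a Cauchy net for every $x\in X$. *)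

theory Defs
  imports "HOL-Analysis.Analysis"
begin

section \<open>Nets\<close>

text \<open>A directed set is given by its order relation \<open>r\<close>; the underlying index set is \<open>Field r\<close>,
  and \<open>(i, j) \<in> r\<close> means that \<open>j\<close> comes after \<open>i\<close>. A net is a directed set \<open>r\<close> together with a
  function on the type of indices, of which only the values on \<open>Field r\<close> matter.\<close>

definition directed_set :: "'i rel \<Rightarrow> bool" where
  "directed_set r \<longleftrightarrow> r \<noteq> {} \<and> preorder_on (Field r) r \<and>
     (\<forall>i\<in>Field r. \<forall>j\<in>Field r. \<exists>k. (i, k) \<in> r \<and> (j, k) \<in> r)"

text \<open>The filter of sets of indices containing a tail \<open>{j. i \<le> j}\<close>. Convergence of a net is the
  library's convergence along this filter; \<open>eventually_tail_filter\<close> below spells it out.\<close>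

definition tail_filter :: "'i rel \<Rightarrow> 'i filter" where
  "tail_filter r = (INF i\<in>Field r. principal (r `` {i}))"

definition cauchy_net :: "'i rel \<Rightarrow> ('i \<Rightarrow> 'a::metric_space) \<Rightarrow> bool" where
  "cauchy_net r x \<longleftrightarrow>
     (\<forall>e>0. \<exists>i\<in>Field r. \<forall>j k. (i, j) \<in> r \<longrightarrow> (i, k) \<in> r \<longrightarrow> dist (x j) (x k) < e)"

text \<open>\<open>x \<circ> h\<close>, indexed by \<open>s\<close>, is a subnet of the net \<open>x\<close>, indexed by \<open>r\<close>.\<close>

definition subnet_map :: "'j rel \<Rightarrow> 'i rel \<Rightarrow> ('j \<Rightarrow> 'i) \<Rightarrow> bool" where
  "subnet_map s r h \<longleftrightarrow> directed_set s \<and> h ` Field s \<subseteq> Field r \<and>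
     (\<forall>i\<in>Field r. \<exists>j\<in>Field s. \<forall>k. (j, k) \<in> s \<longrightarrow> (i, h k) \<in> r)"

text \<open>\<open>z\<^sub>i \<rightarrow> \<infinity>\<close> in \<open>Z\<close>: the net has no convergent subnet in \<open>Z\<close>. A definition cannot quantify over
  the type of the indices of the subnets. The type chosen here is large enough: by
  \<open>tends_to_infinity_no_subnet\<close> below no subnet indexed by any other type converges either.\<close>

definition tends_to_infinity :: "'z topology \<Rightarrow> 'i rel \<Rightarrow> ('i \<Rightarrow> 'z) \<Rightarrow> bool" where
  "tends_to_infinity Z r z \<longleftrightarrow>
     \<not> (\<exists>(s :: ('i \<times> 'z set) rel) h l. subnet_map s r h \<and> limitin Z (z \<circ> h) l (tail_filter s))"


section \<open>The group of isometries and its action\<close>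

definition Iso :: "('a::metric_space \<Rightarrow> 'a) set" where
  "Iso = {g. surj g \<and> (\<forall>x y. dist (g x) (g y) = dist x y)}"

text \<open>The topology of pointwise convergence\<close>

definition Iso_topology :: "('a::metric_space \<Rightarrow> 'a) topology" where
  "Iso_topology = subtopology (product_topology (\<lambda>_. euclidean) UNIV) Iso"

text \<open>The type of the indices of the nets of points of \<open>Z\<close>, \<open>'z\<close> being the type of these points.
  Every net of points of \<open>Z\<close>, whatever its index type, may be replaced by one indexed by the
  pairs \<open>(p, A)\<close> with \<open>A\<close> the set of values on a tail and \<open>p \<in> A\<close>. The lemmas
  \<open>proper_action_any_index\<close> and \<open>Cauchy_indivisible_any_index\<close> below show that the following two
  definitions do not depend on the choice of this type.\<close>

type_synonym 'z net_index = "'z \<times> 'z set"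

definition proper_action :: "('a::metric_space \<Rightarrow> 'a) topology \<Rightarrow> bool" where
  "proper_action G \<longleftrightarrow>
     (\<forall>x. \<not> (\<exists>y (r :: ('a \<times> ('a \<Rightarrow> 'a)) net_index rel) xs gs.
        directed_set r \<and> gs ` Field r \<subseteq> topspace G \<and> tends_to_infinity G r gs \<and>
        (xs \<longlongrightarrow> x) (tail_filter r) \<and> ((\<lambda>i. gs i (xs i)) \<longlongrightarrow> y) (tail_filter r)))"

definition Cauchy_indivisible :: "('a::metric_space \<Rightarrow> 'a) topology \<Rightarrow> bool" where
  "Cauchy_indivisible G \<longleftrightarrow>
     (\<forall>(r :: ('a \<Rightarrow> 'a) net_index rel) gs.
        directed_set r \<and> gs ` Field r \<subseteq> topspace G \<and> tends_to_infinity G r gs \<and>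
        (\<exists>x. cauchy_net r (\<lambda>i. gs i x)) \<longrightarrow> (\<forall>x. cauchy_net r (\<lambda>i. gs i x)))"


section \<open>Independence of the index types\<close>

lemma directed_set_refl: "directed_set r \<Longrightarrow> i \<in> Field r \<Longrightarrow> (i, i) \<in> r"
  by (auto simp: directed_set_def preorder_on_def dest: refl_onD)

lemma directed_set_trans: "directed_set r \<Longrightarrow> (i, j) \<in> r \<Longrightarrow> (j, k) \<in> r \<Longrightarrow> (i, k) \<in> r"
  by (auto simp: directed_set_def preorder_on_def dest: transD)

lemma directed_set_ub:
  assumes "directed_set r" "i \<in> Field r" "j \<in> Field r"
  obtains k where "k \<in> Field r" "(i, k) \<in> r" "(j, k) \<in> r"
  using assms unfolding directed_set_def by (metis FieldI2)

lemma directed_set_nonempty: "directed_set r \<Longrightarrow> Field r \<noteq> {}"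
  by (auto simp: directed_set_def Field_def)

lemma eventually_tail_filter:
  assumes "directed_set r"
  shows "eventually P (tail_filter r) \<longleftrightarrow> (\<exists>i\<in>Field r. \<forall>j. (i, j) \<in> r \<longrightarrow> P j)"
proof -
  have "\<exists>k\<in>Field r. principal (r `` {k}) \<le> inf (principal (r `` {i})) (principal (r `` {j}))"
    if ij: "i \<in> Field r" "j \<in> Field r" for i j
  proof -
    obtain k where "k \<in> Field r" "(i, k) \<in> r" "(j, k) \<in> r"
      by (rule directed_set_ub[OF assms ij])
    then show ?thesis
      by (intro bexI[of _ k]) (auto intro: directed_set_trans[OF assms])
  qed
  then show ?thesis
    unfolding tail_filter_def
    by (subst eventually_INF_base)
      (simp_all add: eventually_principal directed_set_nonempty[OF assms] Ball_def)
qed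

lemma cauchy_net_iff_filtermap:
  assumes "directed_set r"
  shows "cauchy_net r x \<longleftrightarrow>
    (\<forall>e>0. \<exists>A. eventually (\<lambda>p. p \<in> A) (filtermap x (tail_filter r)) \<and> (\<forall>p\<in>A. \<forall>q\<in>A. dist p q < e))"
    (is "_ \<longleftrightarrow> ?R")
proof
  assume c: "cauchy_net r x"
  show ?R
  proof (intro allI impI)
    fix e :: real assume "e > 0"
    then obtain i where i: "i \<in> Field r" "\<forall>j k. (i, j) \<in> r \<longrightarrow> (i, k) \<in> r \<longrightarrow> dist (x j) (x k) < e"
      using c unfolding cauchy_net_def by blast
    show "\<exists>A. eventually (\<lambda>p. p \<in> A) (filtermap x (tail_filter r)) \<and> (\<forall>p\<in>A. \<forall>q\<in>A. dist p q < e)"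
      by (rule exI[of _ "x ` (r `` {i})"])
        (use i in \<open>auto simp: eventually_filtermap eventually_tail_filter[OF assms]\<close>)
  qed
next
  assume R: ?R
  show "cauchy_net r x"
    unfolding cauchy_net_def
  proof (intro allI impI)
    fix e :: real assume "e > 0"
    then obtain A where "eventually (\<lambda>p. p \<in> A) (filtermap x (tail_filter r))"
      "\<forall>p\<in>A. \<forall>q\<in>A. dist p q < e" using R by blast
    then show "\<exists>i\<in>Field r. \<forall>j k. (i, j) \<in> r \<longrightarrow> (i, k) \<in> r \<longrightarrow> dist (x j) (x k) < e"
      unfolding eventually_filtermap eventually_tail_filter[OF assms] by blast
  qed
qed

lemma convergent_subnet_imp_frequently:
  assumes r: "directed_set r" and s: "subnet_map s r h"
    and lim: "limitin Z (z \<circ> h) l (tail_filter s)"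
    and U: "openin Z U" "l \<in> U"
  shows "frequently (\<lambda>i. z i \<in> U) (tail_filter r)"
  unfolding frequently_def
proof
  assume "eventually (\<lambda>i. z i \<notin> U) (tail_filter r)"
  then obtain i where i: "i \<in> Field r" "\<forall>j. (i, j) \<in> r \<longrightarrow> z j \<notin> U"
    using eventually_tail_filter[OF r] by metis
  have ds: "directed_set s" using s by (simp add: subnet_map_def)
  obtain j where j: "j \<in> Field s" "\<forall>k. (j, k) \<in> s \<longrightarrow> (i, h k) \<in> r"
    using s i unfolding subnet_map_def by blast
  have "eventually (\<lambda>k. (z \<circ> h) k \<in> U) (tail_filter s)"
    using lim U unfolding limitin_def by blast
  then obtain j' where j': "j' \<in> Field s" "\<forall>k. (j', k) \<in> s \<longrightarrow> z (h k) \<in> U"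
    unfolding eventually_tail_filter[OF ds] by auto
  obtain k where "(j, k) \<in> s" "(j', k) \<in> s"
    using directed_set_ub ds j j' by metis
  then show False using i j j' by blast
qed

lemma frequently_imp_convergent_subnet:
  fixes r :: "'i rel" and z :: "'i \<Rightarrow> 'z"
  assumes r: "directed_set r" and l: "l \<in> topspace Z"
    and freq: "\<And>U. openin Z U \<Longrightarrow> l \<in> U \<Longrightarrow> frequently (\<lambda>i. z i \<in> U) (tail_filter r)"
  shows "\<exists>(s :: ('i \<times> 'z set) rel) h. subnet_map s r h \<and> limitin Z (z \<circ> h) l (tail_filter s)"
proof -
  define J where "J = {(i, U). i \<in> Field r \<and> openin Z U \<and> l \<in> U \<and> z i \<in> U}"
  define s where "s = {((i, U), (j, V)). (i, U) \<in> J \<and> (j, V) \<in> J \<and> (i, j) \<in> r \<and> V \<subseteq> U}"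
  have later: "\<exists>j. (i, j) \<in> r \<and> (j, U) \<in> J" if "i \<in> Field r" "openin Z U" "l \<in> U" for i U
    using freq[OF that(2,3)] that unfolding frequently_def eventually_tail_filter[OF r] J_def
    by (auto intro: FieldI2)
  have Fs: "Field s = J"
  proof
    show "Field s \<subseteq> J" by (auto simp: s_def Field_def)
    show "J \<subseteq> Field s"
    proof
      fix p assume "p \<in> J"
      then have "(p, p) \<in> s" by (auto simp: s_def J_def intro: directed_set_refl[OF r])
      then show "p \<in> Field s" by (rule FieldI1)
    qed
  qed
  obtain i0 where i0: "i0 \<in> Field r" using directed_set_nonempty[OF r] by blast
  have ne: "s \<noteq> {}"
    using later[OF i0 openin_topspace l] Fs by (auto simp: Field_def)
  have pre: "preorder_on J s"
    unfolding preorder_on_def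
  proof (intro conjI)
    show "s \<subseteq> J \<times> J" by (auto simp: s_def)
    show "refl_on J s" by (rule refl_onI) (auto simp: s_def J_def intro: directed_set_refl[OF r])
    show "trans s" by (rule transI) (auto simp: s_def intro: directed_set_trans[OF r])
  qed
  have dir: "\<exists>q. (p1, q) \<in> s \<and> (p2, q) \<in> s" if p12: "p1 \<in> J" "p2 \<in> J" for p1 p2
  proof -
    obtain i U j V where p: "p1 = (i, U)" "p2 = (j, V)" by (metis surj_pair)
    then have ij: "i \<in> Field r" "j \<in> Field r" "openin Z (U \<inter> V)" "l \<in> U \<inter> V"
      using p12 by (auto simp: J_def)
    obtain k where k: "k \<in> Field r" "(i, k) \<in> r" "(j, k) \<in> r"
      using directed_set_ub r ij by metis
    obtain m where m: "(k, m) \<in> r" "(m, U \<inter> V) \<in> J" using later k ij by metis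
    have "(i, m) \<in> r" "(j, m) \<in> r" using k m directed_set_trans[OF r] by blast+
    then show ?thesis using p p12 m by (intro exI[of _ "(m, U \<inter> V)"]) (auto simp: s_def)
  qed
  have ds: "directed_set s"
    unfolding directed_set_def Fs using ne pre dir by blast
  have sub: "subnet_map s r fst"
    unfolding subnet_map_def Fs
  proof (intro conjI ballI ds)
    show "fst ` J \<subseteq> Field r" by (auto simp: J_def)
    fix i assume i: "i \<in> Field r"
    obtain j where j: "(i, j) \<in> r" "(j, topspace Z) \<in> J" using later[OF i openin_topspace l] by blast
    show "\<exists>j\<in>J. \<forall>k. (j, k) \<in> s \<longrightarrow> (i, fst k) \<in> r"
      by (rule bexI[OF _ j(2)]) (auto simp: s_def intro: directed_set_trans[OF r j(1)])
  qed
  have "limitin Z (z \<circ> fst) l (tail_filter s)"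
    unfolding limitin_def eventually_tail_filter[OF ds] Fs
  proof (intro conjI allI impI l)
    fix U assume U: "openin Z U \<and> l \<in> U"
    then obtain j where j: "(j, U) \<in> J" using later[OF i0] by blast
    show "\<exists>i\<in>J. \<forall>j. (i, j) \<in> s \<longrightarrow> (z \<circ> fst) j \<in> U"
      by (rule bexI[OF _ j]) (auto simp: s_def J_def)
  qed
  with sub show ?thesis by blast
qed

lemma tends_to_infinity_iff:
  fixes r :: "'i rel" and z :: "'i \<Rightarrow> 'z"
  assumes "directed_set r"
  shows "tends_to_infinity Z r z \<longleftrightarrow>
    (\<forall>l\<in>topspace Z. \<exists>U. openin Z U \<and> l \<in> U \<and> eventually (\<lambda>p. p \<notin> U) (filtermap z (tail_filter r)))"
    (is "_ \<longleftrightarrow> ?R")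
proof
  assume T: "tends_to_infinity Z r z"
  show ?R
  proof
    fix l assume l: "l \<in> topspace Z"
    show "\<exists>U. openin Z U \<and> l \<in> U \<and> eventually (\<lambda>p. p \<notin> U) (filtermap z (tail_filter r))"
    proof (rule ccontr)
      assume "\<not> ?thesis"
      then have "frequently (\<lambda>i. z i \<in> U) (tail_filter r)" if "openin Z U" "l \<in> U" for U
        using that by (auto simp: frequently_def eventually_filtermap)
      from frequently_imp_convergent_subnet[OF assms l this] T show False
        unfolding tends_to_infinity_def by blast
    qed
  qed
next
  assume R: ?R
  show "tends_to_infinity Z r z"
    unfolding tends_to_infinity_def
  proof clarify
    fix s :: "('i \<times> 'z set) rel" and h l
    assume s: "subnet_map s r h" "limitin Z (z \<circ> h) l (tail_filter s)"
    then have "l \<in> topspace Z" by (simp add: limitin_def)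
    then obtain U where "openin Z U" "l \<in> U" "eventually (\<lambda>i. z i \<notin> U) (tail_filter r)"
      using R by (auto simp: eventually_filtermap)
    then show False
      using convergent_subnet_imp_frequently[OF assms s] by (auto simp: frequently_def)
  qed
qed

lemma tends_to_infinity_no_subnet:
  assumes "directed_set r" "tends_to_infinity Z r z" "subnet_map s r h"
  shows "\<not> limitin Z (z \<circ> h) l (tail_filter s)"
proof
  assume lim: "limitin Z (z \<circ> h) l (tail_filter s)"
  then have l: "l \<in> topspace Z" by (simp add: limitin_def)
  from frequently_imp_convergent_subnet[OF assms(1) l convergent_subnet_imp_frequently[OF assms(1,3) lim]]
  show False using assms(2) unfolding tends_to_infinity_def by blast
qed

lemma canonical_net:
  fixes r :: "'i rel" and z :: "'i \<Rightarrow> 'z"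
  assumes r: "directed_set r"
  obtains s :: "'z net_index rel" where "directed_set s" "fst ` Field s \<subseteq> z ` Field r"
    "filtermap fst (tail_filter s) = filtermap z (tail_filter r)"
proof -
  define T where "T i = z ` (r `` {i})" for i
  define J where "J = {(p, A). \<exists>i\<in>Field r. A = T i \<and> p \<in> A}"
  define s where "s = {((p, A), (q, B)). (p, A) \<in> J \<and> (q, B) \<in> J \<and> B \<subseteq> A}"
  have inJ: "(z j, T i) \<in> J" if "(i, j) \<in> r" for i j
    using that by (auto simp: J_def T_def intro: FieldI1)
  have Fs: "Field s = J"
    by (auto simp: s_def Field_def)
  have mono: "T j \<subseteq> T i" if "(i, j) \<in> r" for i j
    using that by (auto simp: T_def intro: directed_set_trans[OF r])
  obtain i0 where i0: "i0 \<in> Field r" using directed_set_nonempty[OF r] by blast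
  have "J \<noteq> {}" using inJ[OF directed_set_refl[OF r i0]] by blast
  then have ne: "s \<noteq> {}" using Fs by (auto simp: Field_def)
  have pre: "preorder_on J s"
    unfolding preorder_on_def
  proof (intro conjI)
    show "s \<subseteq> J \<times> J" by (auto simp: s_def)
    show "refl_on J s" by (rule refl_onI) (auto simp: s_def)
    show "trans s" by (rule transI) (auto simp: s_def)
  qed
  have dir: "\<exists>v. (u1, v) \<in> s \<and> (u2, v) \<in> s" if u12: "u1 \<in> J" "u2 \<in> J" for u1 u2
  proof -
    obtain i j p q where u: "u1 = (p, T i)" "u2 = (q, T j)" and ij: "i \<in> Field r" "j \<in> Field r"
      using u12 by (auto simp: J_def)
    obtain k where k: "k \<in> Field r" "(i, k) \<in> r" "(j, k) \<in> r"
      using directed_set_ub r ij by metis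
    have "(z k, T k) \<in> J" using inJ directed_set_refl[OF r k(1)] by blast
    then show ?thesis
      using u u12 mono k by (intro exI[of _ "(z k, T k)"]) (auto simp: s_def)
  qed
  have ds: "directed_set s"
    unfolding directed_set_def Fs using ne pre dir by blast
  have "fst ` Field s \<subseteq> z ` Field r"
    unfolding Fs by (auto simp: J_def T_def intro: FieldI2)
  moreover have "filtermap fst (tail_filter s) = filtermap z (tail_filter r)"
  proof (rule filter_eq_iff[THEN iffD2], rule allI)
    fix P
    show "eventually P (filtermap fst (tail_filter s)) \<longleftrightarrow> eventually P (filtermap z (tail_filter r))"
      unfolding eventually_filtermap eventually_tail_filter[OF ds] eventually_tail_filter[OF r] Fs
    proof
      assume "\<exists>u\<in>J. \<forall>v. (u, v) \<in> s \<longrightarrow> P (fst v)"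
      then obtain p i where u: "i \<in> Field r" "(p, T i) \<in> J" "\<forall>v. ((p, T i), v) \<in> s \<longrightarrow> P (fst v)"
        by (auto simp: J_def)
      have "P (z j)" if "(i, j) \<in> r" for j
        using u(3)[rule_format, of "(z j, T i)"] u(2) inJ[OF that] by (auto simp: s_def)
      then show "\<exists>i\<in>Field r. \<forall>j. (i, j) \<in> r \<longrightarrow> P (z j)" using u(1) by blast
    next
      assume "\<exists>i\<in>Field r. \<forall>j. (i, j) \<in> r \<longrightarrow> P (z j)"
      then obtain i where i: "i \<in> Field r" "\<forall>j. (i, j) \<in> r \<longrightarrow> P (z j)" by blast
      have "P (fst v)" if "((z i, T i), v) \<in> s" for v
        using that i(2) by (auto simp: s_def J_def T_def)
      then show "\<exists>u\<in>J. \<forall>v. (u, v) \<in> s \<longrightarrow> P (fst v)"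
        using inJ[OF directed_set_refl[OF r i(1)]] by blast
    qed
  qed
  ultimately show thesis using that ds by blast
qed

lemma proper_action_any_index:
  fixes r :: "'i rel" and G :: "('a::metric_space \<Rightarrow> 'a) topology"
  assumes G: "proper_action G" and r: "directed_set r" and gs: "gs ` Field r \<subseteq> topspace G"
    and x: "(xs \<longlongrightarrow> x) (tail_filter r)" and y: "((\<lambda>i. gs i (xs i)) \<longlongrightarrow> y) (tail_filter r)"
  shows "\<not> tends_to_infinity G r gs"
proof
  assume inf: "tends_to_infinity G r gs"
  define z where "z i = (xs i, gs i)" for i
  obtain s :: "('a \<times> ('a \<Rightarrow> 'a)) net_index rel"
    where s: "directed_set s" "fst ` Field s \<subseteq> z ` Field r"
      "filtermap fst (tail_filter s) = filtermap z (tail_filter r)"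
    using canonical_net[OF r] by metis
  have tr: "filtermap (\<lambda>v. f (fst v)) (tail_filter s) = filtermap (\<lambda>i. f (z i)) (tail_filter r)"
    for f :: "'a \<times> ('a \<Rightarrow> 'a) \<Rightarrow> 'b"
    using arg_cong[OF s(3), of "filtermap f"] by (simp add: filtermap_filtermap)
  have "(\<lambda>v. snd (fst v)) ` Field s \<subseteq> topspace G"
    using s(2) gs by (fastforce simp: z_def)
  moreover have "tends_to_infinity G s (\<lambda>v. snd (fst v))"
    using inf unfolding tends_to_infinity_iff[OF s(1)] tends_to_infinity_iff[OF r] tr
    by (simp add: z_def)
  moreover have "((\<lambda>v. fst (fst v)) \<longlongrightarrow> x) (tail_filter s)"
    using x unfolding filterlim_def tr by (simp add: z_def)
  moreover have "((\<lambda>v. snd (fst v) (fst (fst v))) \<longlongrightarrow> y) (tail_filter s)"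
    using y tr[of "\<lambda>p. snd p (fst p)"] unfolding filterlim_def by (simp add: z_def)
  ultimately show False
    using G s(1) unfolding proper_action_def by blast
qed

lemma Cauchy_indivisible_any_index:
  fixes r :: "'i rel" and G :: "('a::metric_space \<Rightarrow> 'a) topology"
  assumes G: "Cauchy_indivisible G" and r: "directed_set r" and gs: "gs ` Field r \<subseteq> topspace G"
    and inf: "tends_to_infinity G r gs" and x: "cauchy_net r (\<lambda>i. gs i x)"
  shows "cauchy_net r (\<lambda>i. gs i y)"
proof -
  obtain s :: "('a \<Rightarrow> 'a) net_index rel"
    where s: "directed_set s" "fst ` Field s \<subseteq> gs ` Field r"
      "filtermap fst (tail_filter s) = filtermap gs (tail_filter r)"
    using canonical_net[OF r] by metis
  have tr: "filtermap (\<lambda>v. fst v x) (tail_filter s) = filtermap (\<lambda>i. gs i x) (tail_filter r)" for x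
    using arg_cong[OF s(3), of "filtermap (\<lambda>g. g x)"] by (simp add: filtermap_filtermap)
  have c: "cauchy_net s (\<lambda>v. fst v x) \<longleftrightarrow> cauchy_net r (\<lambda>i. gs i x)" for x
    unfolding cauchy_net_iff_filtermap[OF r] cauchy_net_iff_filtermap[OF s(1)] tr ..
  have "fst ` Field s \<subseteq> topspace G" using s(2) gs by blast
  moreover have "tends_to_infinity G s fst"
    using inf unfolding tends_to_infinity_iff[OF s(1)] tends_to_infinity_iff[OF r] s(3) .
  ultimately have "\<forall>y. cauchy_net s (\<lambda>v. fst v y)"
    using G s(1) x c unfolding Cauchy_indivisible_def by blast
  then show ?thesis using c by blast
qed

end

theory Submission
  imports Defs
begin

text \<open>A sufficiently late term of a Cauchy net \<open>g\<^sub>i x\<close> has all later terms in the isometric image of a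
  compact neighbourhood of \<open>x\<close>. Hence, although \<open>X\<close> need not be complete, every Cauchy net of the
  form \<open>g\<^sub>i x\<close> converges, and properness makes Cauchy-indivisibility vacuous. Conversely, if
  \<open>x\<^sub>i \<rightarrow> x\<close> and \<open>g\<^sub>i x\<^sub>i \<rightarrow> y\<close>, then \<open>g\<^sub>i x \<rightarrow> y\<close> and \<open>g\<^sub>i\<^sup>-\<^sup>1 y \<rightarrow> x\<close>; Cauchy-indivisibility applied to both nets
  yields pointwise limits of \<open>g\<^sub>i\<close> and of \<open>g\<^sub>i\<^sup>-\<^sup>1\<close>, which are mutually inverse isometries.\<close>

section \<open>Isometries, their inverses and pointwise convergence\<close>

lemma Iso_dist: "g \<in> Iso \<Longrightarrow> dist (g x) (g y) = dist x y"
  by (simp add: Iso_def)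

lemma Iso_bij: "g \<in> Iso \<Longrightarrow> bij g"
  unfolding Iso_def bij_def inj_def by clarsimp (metis dist_eq_0_iff)

lemma Iso_inv_right [simp]: "g \<in> Iso \<Longrightarrow> g (inv g x) = x"
  by (simp add: Iso_bij bij_is_surj surj_f_inv_f)

lemma Iso_inv:
  assumes g: "g \<in> Iso"
  shows "inv g \<in> Iso"
proof -
  have "dist (inv g x) (inv g y) = dist x y" for x y
    using Iso_dist[OF g, of "inv g x" "inv g y"] by (simp only: Iso_inv_right[OF g])
  moreover have "surj (inv g)"
    using Iso_bij[OF g] by (intro bij_is_surj bij_imp_bij_inv)
  ultimately show ?thesis by (simp add: Iso_def)
qed

lemma Iso_dist_inv: "g \<in> Iso \<Longrightarrow> dist (inv g x) y = dist (g y) x"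
  by (metis Iso_dist Iso_inv_right dist_commute)

lemma topspace_Iso_topology [simp]: "topspace Iso_topology = Iso"
  by (simp add: Iso_topology_def)

lemma limitin_Iso_topology:
  "limitin Iso_topology f l F \<longleftrightarrow>
    l \<in> Iso \<and> eventually (\<lambda>i. f i \<in> Iso) F \<and> (\<forall>x. ((\<lambda>i. f i x) \<longlongrightarrow> l x) F)"
  by (auto simp: Iso_topology_def limitin_subtopology limitin_componentwise)

text \<open>Combined with \<open>Iso_dist_inv\<close>, this converts limits of orbits under
  isometries into limits of orbits under their inverses, and back.\<close>

lemma tendsto_eq_dist:
  assumes "(g \<longlongrightarrow> m) F" "eventually (\<lambda>i. dist (g i) m = dist (f i) l) F"
  shows "(f \<longlongrightarrow> l) F"
  by (rule tendsto_dist_iff[THEN iffD2])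
    (rule Lim_transform_eventually[OF tendsto_dist_iff[THEN iffD1, OF assms(1)] assms(2)])

lemma limitin_Iso_inv:
  assumes "limitin Iso_topology f l F"
  shows "limitin Iso_topology (\<lambda>i. inv (f i)) (inv l) F"
proof -
  have l: "l \<in> Iso" and f: "eventually (\<lambda>i. f i \<in> Iso) F"
    and lim: "((\<lambda>i. f i x) \<longlongrightarrow> l x) F" for x
    using assms by (auto simp: limitin_Iso_topology)
  \<comment> \<open>The distance from \<open>inv (f i) x\<close> to \<open>inv l x\<close> is that
    from \<open>f i (inv l x)\<close> to \<open>x\<close>, and \<open>x\<close> is
    \<open>l (inv l x)\<close>.\<close>
  have "((\<lambda>i. inv (f i) x) \<longlongrightarrow> inv l x) F" for x
    by (rule tendsto_eq_dist[OF lim[of "inv l x"]], use f in eventually_elim)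
      (simp add: Iso_dist_inv l)
  moreover have "eventually (\<lambda>i. inv (f i) \<in> Iso) F"
    using f by eventually_elim (rule Iso_inv)
  ultimately show ?thesis using l by (simp add: limitin_Iso_topology Iso_inv)
qed

section \<open>Nets tending to infinity\<close>

lemma tail_filter_neq_bot: "directed_set r \<Longrightarrow> tail_filter r \<noteq> bot"
  unfolding trivial_limit_def
  by (auto simp: eventually_tail_filter dest: directed_set_refl)

lemma eventually_tail_filter_Field:
  assumes "directed_set r" "\<And>i. i \<in> Field r \<Longrightarrow> P i"
  shows "eventually P (tail_filter r)"
  using assms directed_set_nonempty[OF assms(1)]
  by (auto simp: eventually_tail_filter intro: FieldI2)

lemma tends_to_infinity_not_limitin:
  assumes "directed_set r" "tends_to_infinity Z r z"
  shows "\<not> limitin Z z l (tail_filter r)"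
proof -
  have "subnet_map r r id" using assms(1) by (auto simp: subnet_map_def)
  from tends_to_infinity_no_subnet[OF assms this] show ?thesis by simp
qed

text \<open>Inversion is continuous and involutive, so inverting a convergent subnet of the inverses
  would give a convergent subnet of \<open>gs\<close>.\<close>

lemma tends_to_infinity_Iso_inv:
  fixes gs :: "'i \<Rightarrow> 'a::metric_space \<Rightarrow> 'a"
  assumes gs: "gs ` Field r \<subseteq> Iso" and inf: "tends_to_infinity Iso_topology r gs"
  shows "tends_to_infinity Iso_topology r (\<lambda>i. inv (gs i))"
  unfolding tends_to_infinity_def
proof clarify
  fix s :: "('i \<times> ('a \<Rightarrow> 'a) set) rel" and h l
  assume s: "subnet_map s r h"
    and lim: "limitin Iso_topology ((\<lambda>i. inv (gs i)) \<circ> h) l (tail_filter s)"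
  have ds: "directed_set s" using s by (simp add: subnet_map_def)
  have "eventually (\<lambda>j. inv (inv (gs (h j))) = gs (h j)) (tail_filter s)"
    by (rule eventually_tail_filter_Field[OF ds], rule inv_inv_eq, rule Iso_bij)
      (use s gs in \<open>auto simp: subnet_map_def\<close>)
  moreover have "limitin Iso_topology (\<lambda>j. inv (inv (gs (h j)))) (inv l) (tail_filter s)"
    using limitin_Iso_inv[OF lim] by simp
  ultimately have "limitin Iso_topology (gs \<circ> h) (inv l) (tail_filter s)"
    unfolding comp_def by (rule limitin_transform_eventually)
  with s inf show False unfolding tends_to_infinity_def by blast
qed

section \<open>Cauchy nets and limits of orbits\<close>

lemma tendsto_imp_cauchy_net:
  assumes r: "directed_set r" and lim: "(x \<longlongrightarrow> l) (tail_filter r)"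
  shows "cauchy_net r x"
  unfolding cauchy_net_def
proof (intro allI impI)
  fix e :: real assume "e > 0"
  then have "eventually (\<lambda>i. dist (x i) l < e / 2) (tail_filter r)"
    using lim by (intro tendstoD) auto
  then obtain i where "i \<in> Field r" "\<And>j. (i, j) \<in> r \<Longrightarrow> dist (x j) l < e / 2"
    unfolding eventually_tail_filter[OF r] by blast
  then show "\<exists>i\<in>Field r. \<forall>j k. (i, j) \<in> r \<longrightarrow> (i, k) \<in> r \<longrightarrow> dist (x j) (x k) < e"
    by (meson dist_triangle_half_l)
qed

lemma cauchy_net_complete_convergent:
  assumes r: "directed_set r" and c: "cauchy_net r x"
    and K: "complete K" "eventually (\<lambda>i. x i \<in> K) (tail_filter r)"
  shows "\<exists>l\<in>K. (x \<longlongrightarrow> l) (tail_filter r)"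
proof -
  let ?F = "filtermap x (tail_filter r)"
  have "cauchy_filter ?F"
    unfolding cauchy_filter_metric_filtermap
  proof (intro allI impI)
    fix e :: real assume "e > 0"
    then obtain i where "i \<in> Field r"
      "\<forall>j k. (i, j) \<in> r \<longrightarrow> (i, k) \<in> r \<longrightarrow> dist (x j) (x k) < e"
      using c unfolding cauchy_net_def by blast
    then show "\<exists>P. eventually P (tail_filter r) \<and> (\<forall>j k. P j \<and> P k \<longrightarrow> dist (x j) (x k) < e)"
      by (intro exI[of _ "\<lambda>j. (i, j) \<in> r"]) (auto simp: eventually_tail_filter[OF r])
  qed
  moreover have "?F \<le> principal K"
    using K(2) by (simp add: le_principal eventually_filtermap)
  moreover have "?F \<noteq> bot"
    using tail_filter_neq_bot[OF r] by (simp add: filtermap_bot_iff)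
  ultimately show ?thesis
    using K(1) unfolding complete_uniform filterlim_def by blast
qed

lemma cauchy_net_orbit_convergent:
  fixes gs :: "'i \<Rightarrow> 'a::metric_space \<Rightarrow> 'a"
  assumes lc: "locally_compact_space (euclidean :: 'a topology)"
    and r: "directed_set r" and gs: "gs ` Field r \<subseteq> Iso" and c: "cauchy_net r (\<lambda>i. gs i x)"
  shows "\<exists>y. ((\<lambda>i. gs i x) \<longlongrightarrow> y) (tail_filter r)"
proof -
  obtain U K where U: "open U" "compact K" "x \<in> U" "U \<subseteq> K"
    using lc unfolding locally_compact_space_def by (simp, metis)
  \<comment> \<open>The radius \<open>e\<close> can be fixed before the index \<open>i\<close>: the
    isometry \<open>gs i\<close> carries the ball around \<open>x\<close> to the ball of the same
    radius around \<open>gs i x\<close>.\<close>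
  then obtain e where e: "e > 0" "ball x e \<subseteq> K"
    by (meson openE subset_trans)
  obtain i where i: "i \<in> Field r" "\<And>j k. (i, j) \<in> r \<Longrightarrow> (i, k) \<in> r \<Longrightarrow> dist (gs j x) (gs k x) < e"
    using c e(1) unfolding cauchy_net_def by blast
  have g: "gs i \<in> Iso" using gs i(1) by blast
  have "gs j x \<in> gs i ` K" if "(i, j) \<in> r" for j
  proof -
    have "dist (gs i x) (gs j x) < e"
      using i(2)[OF directed_set_refl[OF r i(1)] that] .
    then have "inv (gs i) (gs j x) \<in> K"
      using e(2) Iso_dist_inv[OF g] by (auto simp: dist_commute)
    then show ?thesis using g by (intro image_eqI[of _ _ "inv (gs i) (gs j x)"]) auto
  qed
  then have "eventually (\<lambda>j. gs j x \<in> gs i ` K) (tail_filter r)"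
    using i(1) by (auto simp: eventually_tail_filter[OF r])
  moreover have "continuous_on K (gs i)"
    using g by (auto simp: continuous_on_iff Iso_dist)
  then have "complete (gs i ` K)"
    using U(2) by (intro compact_imp_complete compact_continuous_image)
  ultimately show ?thesis
    using cauchy_net_complete_convergent[OF r c] by blast
qed

text \<open>Distances pass to the pointwise limit, but surjectivity need not; convergence of the
  inverses supplies it, with \<open>h\<close> as a right inverse of \<open>g\<close>.\<close>

lemma limitin_Iso_topologyI:
  fixes gs :: "'i \<Rightarrow> 'a::metric_space \<Rightarrow> 'a"
  assumes F: "F \<noteq> bot" and gs: "eventually (\<lambda>i. gs i \<in> Iso) F"
    and g: "\<And>x. ((\<lambda>i. gs i x) \<longlongrightarrow> g x) F" and h: "\<And>x. ((\<lambda>i. inv (gs i) x) \<longlongrightarrow> h x) F"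
  shows "limitin Iso_topology gs g F"
proof -
  have "dist (g x) (g y) = dist x y" for x y
  proof (rule tendsto_unique[OF F])
    show "((\<lambda>i. dist (gs i x) (gs i y)) \<longlongrightarrow> dist (g x) (g y)) F"
      by (intro tendsto_dist g)
    have "eventually (\<lambda>i. dist x y = dist (gs i x) (gs i y)) F"
      using gs by eventually_elim (simp add: Iso_dist)
    then show "((\<lambda>i. dist (gs i x) (gs i y)) \<longlongrightarrow> dist x y) F"
      by (rule tendsto_eventually[OF eventually_mono]) simp
  qed
  moreover have "g (h x) = x" for x
  proof (rule tendsto_unique[OF F g])
    \<comment> \<open>The distance from \<open>gs i (h x)\<close> to \<open>x\<close> is that from
      \<open>inv (gs i) x\<close> to \<open>h x\<close>, which tends to 0.\<close>
    show "((\<lambda>i. gs i (h x)) \<longlongrightarrow> x) F"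
      by (rule tendsto_eq_dist[OF h[of x]], use gs in eventually_elim)
        (simp add: Iso_dist_inv)
  qed
  then have "surj g" by (rule surjI)
  ultimately show ?thesis using gs g by (simp add: limitin_Iso_topology Iso_def)
qed

section \<open>The two implications\<close>

lemma proper_action_imp_Cauchy_indivisible:
  assumes lc: "locally_compact_space (euclidean :: 'a::metric_space topology)"
    and p: "proper_action (Iso_topology :: ('a \<Rightarrow> 'a) topology)"
  shows "Cauchy_indivisible (Iso_topology :: ('a \<Rightarrow> 'a) topology)"
  unfolding Cauchy_indivisible_def
proof clarify
  fix r :: "('a \<Rightarrow> 'a) net_index rel" and gs :: "_ \<Rightarrow> 'a \<Rightarrow> 'a" and x y
  assume r: "directed_set r" and gs: "gs ` Field r \<subseteq> topspace Iso_topology"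
    and inf: "tends_to_infinity Iso_topology r gs"
    and c: "cauchy_net r (\<lambda>i. gs i x)"
  obtain l where "((\<lambda>i. gs i x) \<longlongrightarrow> l) (tail_filter r)"
    using cauchy_net_orbit_convergent[where gs = gs and x = x, OF lc r _ c] gs by auto
  \<comment> \<open>The constant net at \<open>x\<close> together with the limit \<open>l\<close> is
    exactly what properness forbids, so the assumptions are contradictory.\<close>
  then show "cauchy_net r (\<lambda>i. gs i y)"
    using proper_action_any_index[OF p r gs tendsto_const, of x l] inf by blast
qed

lemma Cauchy_indivisible_imp_proper_action:
  assumes lc: "locally_compact_space (euclidean :: 'a::metric_space topology)"
    and ci: "Cauchy_indivisible (Iso_topology :: ('a \<Rightarrow> 'a) topology)"
  shows "proper_action (Iso_topology :: ('a \<Rightarrow> 'a) topology)"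
  unfolding proper_action_def
proof clarify
  fix x y and r :: "('a \<times> ('a \<Rightarrow> 'a)) net_index rel" and xs
    and gs :: "_ \<Rightarrow> 'a \<Rightarrow> 'a"
  assume r: "directed_set r" and "gs ` Field r \<subseteq> topspace Iso_topology"
    and inf: "tends_to_infinity Iso_topology r gs" and xs: "(xs \<longlongrightarrow> x) (tail_filter r)"
    and gxs: "((\<lambda>i. gs i (xs i)) \<longlongrightarrow> y) (tail_filter r)"
  then have gs: "gs ` Field r \<subseteq> Iso" by simp
  define F where "F = tail_filter r"
  have ev: "eventually (\<lambda>i. gs i \<in> Iso) F"
    unfolding F_def using gs by (intro eventually_tail_filter_Field[OF r]) auto
  \<comment> \<open>Stated for arbitrary \<open>hs\<close> to serve both \<open>gs\<close> and its
    inverses: one convergent orbit makes all orbits Cauchy, hence convergent. The indices of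
    \<open>r\<close> are those of \<open>proper_action\<close>, hence the appeal to
    \<open>Cauchy_indivisible_any_index\<close>.\<close>
  have pointwise: "\<exists>h. \<forall>w. ((\<lambda>i. hs i w) \<longlongrightarrow> h w) F"
    if "hs ` Field r \<subseteq> Iso" "tends_to_infinity Iso_topology r hs" "((\<lambda>i. hs i u) \<longlongrightarrow> v) F"
    for hs :: "_ \<Rightarrow> 'a \<Rightarrow> 'a" and u v
  proof -
    have "cauchy_net r (\<lambda>i. hs i w)" for w
      using Cauchy_indivisible_any_index[OF ci r _ that(2), of u w] that(1)
        tendsto_imp_cauchy_net[OF r that(3)[unfolded F_def]]
      by simp
    then have "\<exists>l. ((\<lambda>i. hs i w) \<longlongrightarrow> l) F" for w
      unfolding F_def by (rule cauchy_net_orbit_convergent[where gs = hs, OF lc r that(1)])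
    then show ?thesis by metis
  qed
  \<comment> \<open>The moving points \<open>xs i\<close> can be replaced by \<open>x\<close>, since
    \<open>gs i\<close> keeps the distance between \<open>xs i\<close> and \<open>x\<close>.\<close>
  have gx: "((\<lambda>i. gs i x) \<longlongrightarrow> y) F"
  proof (rule tendsto_dist_iff[THEN iffD2])
    have "((\<lambda>i. dist (xs i) x + dist (gs i (xs i)) y) \<longlongrightarrow> 0) F"
      unfolding F_def
      by (rule tendsto_add_zero[OF tendsto_dist_iff[THEN iffD1, OF xs]
            tendsto_dist_iff[THEN iffD1, OF gxs]])
    moreover have "eventually (\<lambda>i. dist (gs i x) y \<le> dist (xs i) x + dist (gs i (xs i)) y) F"
      using ev
    proof eventually_elim
      case (elim i)
      then show ?case
        using dist_triangle[of "gs i x" y "gs i (xs i)"] by (simp add: Iso_dist dist_commute)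
    qed
    ultimately show "((\<lambda>i. dist (gs i x) y) \<longlongrightarrow> 0) F"
      by - (rule tendsto_sandwich[OF always_eventually _ tendsto_const], simp)
  qed
  have giy: "((\<lambda>i. inv (gs i) y) \<longlongrightarrow> x) F"
    by (rule tendsto_eq_dist[OF gx], use ev in eventually_elim) (simp add: Iso_dist_inv)
  obtain g where "\<forall>w. ((\<lambda>i. gs i w) \<longlongrightarrow> g w) F"
    using pointwise[OF gs inf gx] by blast
  moreover obtain h where "\<forall>w. ((\<lambda>i. inv (gs i) w) \<longlongrightarrow> h w) F"
    using pointwise[OF _ tends_to_infinity_Iso_inv[OF gs inf] giy] gs Iso_inv by blast
  \<comment> \<open>The whole net converges in the group, although it was assumed to have no
    convergent subnet.\<close>
  ultimately have "limitin Iso_topology gs g (tail_filter r)"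
    using limitin_Iso_topologyI[where g = g and h = h, OF tail_filter_neq_bot[OF r]] ev
    unfolding F_def by blast
  then show False using tends_to_infinity_not_limitin[OF r inf] by blast
qed

theorem proposition3p2:
  assumes "locally_compact_space (euclidean :: 'a::metric_space topology)"
  shows "proper_action (Iso_topology :: ('a \<Rightarrow> 'a) topology) \<longleftrightarrow>
    Cauchy_indivisible (Iso_topology :: ('a \<Rightarrow> 'a) topology)"
  using proper_action_imp_Cauchy_indivisible[OF assms]
    Cauchy_indivisible_imp_proper_action[OF assms] by blast

end
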